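(* There exists a subset $E$ of $[0,1]$ which is not Lebesgue measurable.
   Context: A set $X\subset\mathbb{R}$ is a null set if for every $\epsilon>0$ there is a sequence of open intervals $\{U_n\}_{n=1}^\infty$ with $X\subset\bigcup_n U_n$ and $\sum_n\mathrm{len}(U_n)<\epsilon$. A set is Lebesgue measurable if it belongs to the $\sigma$-algebra of subsets of $\mathbb{R}$ generated by open intervals and null sets. The Axiom of Choice is assumed. *)

theory Defs
  imports "HOL-Analysis.Analysis"
begin

(* The n-th interval is {a n<..<b n}, with a n = b n giving the empty one; a n \<le> b n makes
   b n - a n its length.  Unbounded intervals cannot occur in a cover of total length < \<epsilon>. *)
definition null_set :: "real set \<Rightarrow> bool" where
  "null_set X \<longleftrightarrow>
     (\<forall>\<epsilon>>0. \<exists>a b :: nat \<Rightarrow> real.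
        (\<forall>n. a n \<le> b n) \<and> X \<subseteq> (\<Union>n. {a n<..<b n}) \<and>
        summable (\<lambda>n. b n - a n) \<and> (\<Sum>n. b n - a n) < \<epsilon>)"

(* Unbounded open intervals are countable unions of bounded ones, so generating with the bounded
   ones loses nothing. *)
definition lebesgue_measurable_set :: "real set \<Rightarrow> bool" where
  "lebesgue_measurable_set A \<longleftrightarrow>
     A \<in> sigma_sets UNIV ({{a<..<b} | a b. True} \<union> {X. null_set X})"

lemma null_set_imp_null_sets_lebesgue:
  assumes "null_set X"
  shows "X \<in> null_sets lebesgue"
proof -
  have "\<exists>T. X \<subseteq> T \<and> T \<in> lmeasurable \<and> measure lebesgue T \<le> e" if e: "e > 0" for e
  proof -
    obtain a b :: "nat \<Rightarrow> real" where ab: "\<And>n. a n \<le> b n" "X \<subseteq> (\<Union>n. {a n<..<b n})"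
      "summable (\<lambda>n. b n - a n)" "(\<Sum>n. b n - a n) < e"
      using assms e unfolding null_set_def by blast
    have "(\<Union>n. {a n<..<b n}) \<in> lmeasurable"
         "measure lebesgue (\<Union>n. {a n<..<b n}) \<le> (\<Sum>n. b n - a n)"
    proof -
      have *: "emeasure lebesgue (\<Union>n. {a n<..<b n}) \<le> ennreal (\<Sum>n. b n - a n)"
      proof -
        have "emeasure lebesgue (\<Union>n. {a n<..<b n}) \<le> (\<Sum>n. emeasure lebesgue {a n<..<b n})"
          by (intro emeasure_subadditive_countably) auto
        also have "\<dots> = (\<Sum>n. ennreal (b n - a n))"
          using ab(1) by simp
        also have "\<dots> = ennreal (\<Sum>n. b n - a n)"
          using ab(1,3) by (intro suminf_ennreal2) auto
        finally show ?thesis .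
      qed
      show "(\<Union>n. {a n<..<b n}) \<in> lmeasurable"
        using le_less_trans[OF * ennreal_less_top] by (intro fmeasurableI) (auto simp: less_top)
      show "measure lebesgue (\<Union>n. {a n<..<b n}) \<le> (\<Sum>n. b n - a n)"
        unfolding measure_def using * ab(1,3) by (intro enn2real_leI suminf_nonneg) auto
    qed
    then show ?thesis using ab(2,4) by (meson le_less_trans less_imp_le)
  qed
  then have "negligible X" by (auto simp: negligible_outer_le)
  then show ?thesis by (simp add: negligible_iff_null_sets)
qed

lemma open_finite_measure_interval_cover:
  fixes U :: "real set"
  assumes U: "open U" "U \<in> lmeasurable"
  obtains a b :: "nat \<Rightarrow> real" where "\<And>n. a n \<le> b n" "U = (\<Union>n. {a n<..<b n})"
    "(\<lambda>n. b n - a n) sums measure lebesgue U"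
proof -
  have ival: "\<exists>a b. a \<le> b \<and> C = {a<..<b}" if C: "C \<in> components U" for C
  proof -
    have CU: "C \<subseteq> U" and ne: "C \<noteq> {}" and op: "open C" and con: "connected C"
      using in_components_subset[OF C] in_components_nonempty[OF C] open_components[OF U(1) C]
        in_components_connected[OF C] by simp_all
    have seg: "{x..y} \<subseteq> C" if "x \<in> C" "y \<in> C" for x y
      using con that connected_contains_Icc by blast
    have d: "y - x \<le> measure lebesgue U" if "x \<in> C" "y \<in> C" for x y
    proof (cases "x \<le> y")
      case True
      then have "y - x = measure lebesgue {x..y}" by simp
      also have "\<dots> \<le> measure lebesgue U"
        using seg[OF that] CU U by (intro measure_mono_fmeasurable) auto
      finally show ?thesis .
    next
      case False
      then show ?thesis using measure_nonneg[of lebesgue U] by linarith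
    qed
    obtain c where c: "c \<in> C" using ne by blast
    have bdd: "bdd_above C" "bdd_below C"
      using d[OF c] d[OF _ c]
      by (auto intro!: bdd_aboveI[of _ "c + measure lebesgue U"]
          bdd_belowI[of _ "c - measure lebesgue U"] simp: algebra_simps)
    have lim: "Inf C < x \<and> x < Sup C" if x: "x \<in> C" for x
    proof -
      obtain r where r: "r > 0" "ball x r \<subseteq> C" using op x openE by blast
      then have "x - r/2 \<in> C" "x + r/2 \<in> C" by (auto simp: subset_iff dist_real_def)
      then have "Inf C \<le> x - r/2" "x + r/2 \<le> Sup C"
        using bdd by (auto intro: cInf_lower cSup_upper)
      then show ?thesis using r by linarith
    qed
    have "x \<in> C" if x: "Inf C < x" "x < Sup C" for x
    proof -
      obtain y z where "y \<in> C" "y < x" "z \<in> C" "x < z"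
        using x ne bdd by (meson cInf_lessD less_cSupD)
      then show ?thesis using seg[of y z] by force
    qed
    then have "C = {Inf C<..<Sup C}" using lim by auto
    moreover have "Inf C \<le> Sup C" using lim[OF c] by linarith
    ultimately show ?thesis by blast
  qed
  then obtain l r where lr: "\<And>C. C \<in> components U \<Longrightarrow> l C \<le> r C \<and> C = {l C<..<r C}"
    by metis
  have cnt: "countable (components U)"
    using U pairwise_disjoint_components[of U]
    by (intro countable_disjoint_open_subsets) (auto simp: pairwise_def disjnt_def open_components)
  define K where "K = components U"
  define N where "N = to_nat_on K ` K"
  define a where "a n = (if n \<in> N then l (from_nat_into K n) else 0)" for n
  define b where "b n = (if n \<in> N then r (from_nat_into K n) else 0)" for n
  have K: "from_nat_into K n \<in> K" if "n \<in> N" for n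
    using that cnt unfolding N_def K_def by auto
  have eq: "{a n<..<b n} = (if n \<in> N then from_nat_into K n else {})" for n
    using lr[of "from_nat_into K n"] K[of n] unfolding a_def b_def K_def by auto
  have le: "a n \<le> b n" for n
    using lr[of "from_nat_into K n"] K[of n] unfolding a_def b_def K_def by auto
  have "(\<Union>n. {a n<..<b n}) = \<Union>K"
  proof -
    have "\<exists>n\<in>N. from_nat_into K n = C" if "C \<in> K" for C
      using that cnt unfolding N_def K_def by force
    then show ?thesis using K unfolding eq by (fastforce split: if_splits)
  qed
  then have UN: "U = (\<Union>n. {a n<..<b n})"
    unfolding K_def by (simp add: Union_components)
  have disj: "disjoint_family (\<lambda>n. {a n<..<b n})"
  proof -
    have "from_nat_into K m \<inter> from_nat_into K n = {}" if "m \<in> N" "n \<in> N" "m \<noteq> n" for m n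
    proof -
      have "from_nat_into K m \<noteq> from_nat_into K n"
        using that cnt unfolding N_def K_def by auto
      then show ?thesis
        using K[OF that(1)] K[OF that(2)] components_nonoverlap unfolding K_def by blast
    qed
    then show ?thesis unfolding disjoint_family_on_def eq by auto
  qed
  have "(\<lambda>n. measure lebesgue {a n<..<b n}) sums measure lebesgue (\<Union>n. {a n<..<b n})"
    using disj U UN by (intro measure_UNION) (auto simp: fmeasurable_def less_top)
  then have "(\<lambda>n. b n - a n) sums measure lebesgue U"
    using le UN by simp
  then show ?thesis using that le UN by blast
qed

lemma null_set_iff_null_sets_lebesgue: "null_set X \<longleftrightarrow> X \<in> null_sets lebesgue"
proof
  assume X: "X \<in> null_sets lebesgue"
  show "null_set X"
    unfolding null_set_def
  proof (intro allI impI)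
    fix e :: real assume e: "e > 0"
    obtain U where U: "open U" "X \<subseteq> U" "U - X \<in> lmeasurable" "emeasure lebesgue (U - X) < ennreal e"
      using sets_lebesgue_outer_open[of X e] X e by (metis null_setsD2)
    have "U \<in> lmeasurable" "measure lebesgue U < e"
    proof -
      have "emeasure lebesgue (U - X) = emeasure lebesgue U"
        using X U by (intro emeasure_Diff_null_set) auto
      then have *: "emeasure lebesgue U < ennreal e" using U by simp
      then show um: "U \<in> lmeasurable"
        using U by (intro fmeasurableI) (auto intro: less_trans[OF _ ennreal_less_top])
      show "measure lebesgue U < e"
        using * e um by (simp add: emeasure_eq_measure2 ennreal_less_iff)
    qed
    moreover obtain a b where "\<And>n. a n \<le> b n" "U = (\<Union>n. {a n<..<b n})"
      "(\<lambda>n. b n - a n) sums measure lebesgue U"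
      using open_finite_measure_interval_cover U calculation by blast
    ultimately show "\<exists>a b :: nat \<Rightarrow> real. (\<forall>n. a n \<le> b n) \<and> X \<subseteq> (\<Union>n. {a n<..<b n}) \<and>
        summable (\<lambda>n. b n - a n) \<and> (\<Sum>n. b n - a n) < e"
      using U(2) by (metis sums_summable sums_unique)
  qed
qed (rule null_set_imp_null_sets_lebesgue)

lemma lebesgue_measurable_set_iff: "lebesgue_measurable_set A \<longleftrightarrow> A \<in> sets lebesgue"
proof
  assume A: "lebesgue_measurable_set A"
  have "sigma_sets UNIV ({{a<..<b} | a b. True} \<union> {X. null_set X}) \<subseteq> sets lebesgue"
    using null_set_iff_null_sets_lebesgue
    by (intro sets.sigma_sets_subset[of _ lebesgue, simplified]) auto
  then show "A \<in> sets lebesgue"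
    using A unfolding lebesgue_measurable_set_def by blast
next
  let ?G = "{{a<..<b} | a b. True} \<union> {X. null_set X}"
  assume "A \<in> sets lebesgue"
  then obtain B Z where BZ: "B \<in> sets borel" "negligible Z" "B \<union> Z = A"
    using sets_lebesgue_almost_borel by blast
  have "sets (borel :: real measure) = sigma_sets UNIV (range (\<lambda>(a, b). box a b))"
    by (simp add: borel_eq_box)
  also have "\<dots> \<subseteq> sigma_sets UNIV ?G"
    by (intro sigma_sets_mono') (auto simp: box_real)
  finally have "B \<in> sigma_sets UNIV ?G" using BZ by blast
  moreover have "Z \<in> sigma_sets UNIV ?G"
    using BZ(2) by (intro sigma_sets.Basic)
      (simp add: null_set_iff_null_sets_lebesgue negligible_iff_null_sets)
  ultimately show "lebesgue_measurable_set A"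
    unfolding lebesgue_measurable_set_def using BZ(3) sigma_sets_Un by blast
qed

end

theory Submission
  imports Defs
begin

text \<open>
  The witness is a Vitali set: a choice of one point of \<open>[0,1]\<close> from each class of reals modulo
  \<open>\<rat>\<close> that meets it.  Its translates by the rationals of \<open>[-1,1]\<close> are pairwise disjoint, since
  the chosen points are pairwise inequivalent; they cover \<open>[0,1]\<close>, since a point and its
  representative are at distance at most one; and they stay inside \<open>[-1,2]\<close>.  If the set had a
  Lebesgue measure \<open>c\<close>, translation invariance would give every translate measure \<open>c\<close>.  The
  infinitely many disjoint translates fit into a set of measure 3, so \<open>c = 0\<close>; but then countably
  many null sets would cover \<open>[0,1]\<close>.  The argument runs in the measure space \<open>lebesgue\<close>, whose
  measurable sets are those of the generated \<open>\<sigma>\<close>-algebra by \<open>lebesgue_measurable_set_iff\<close>.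
\<close>

text \<open>
  Countable additivity turns the measure of the union of the translates into \<open>\<infinity> * c\<close>, where \<open>c\<close>
  is the measure of the set, and a finite value of this product leaves only \<open>c = 0\<close>.
\<close>

lemma null_set_if_infinitely_many_disjoint_bounded_translates:
  fixes V Q :: "real set"
  assumes V: "V \<in> sets lebesgue"
    and Q: "countable Q" "infinite Q"
    and disj: "disjoint_family_on (\<lambda>q. (+) q ` V) Q"
    and bounded: "bounded (\<Union>q\<in>Q. (+) q ` V)"
  shows "(\<Union>q\<in>Q. (+) q ` V) \<in> null_sets lebesgue"
proof -
  let ?U = "\<Union>q\<in>Q. (+) q ` V"
  have meas: "(+) q ` V \<in> sets lebesgue" for q
    using V by (rule lebesgue_sets_translation)
  have invariant: "emeasure lebesgue ((+) q ` V) = emeasure lebesgue V" for q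
    using emeasure_lebesgue_affine[of 1 q V] by (simp add: add.commute[of q, abs_def])
  have "emeasure lebesgue ?U = (\<integral>\<^sup>+q. emeasure lebesgue ((+) q ` V) \<partial>count_space Q)"
    using meas Q(1) disj by (intro emeasure_UN_countable) auto
  also have "\<dots> = emeasure lebesgue V * \<infinity>"
    using Q(2) by (simp add: invariant)
  finally have U: "emeasure lebesgue ?U = emeasure lebesgue V * \<infinity>" .
  have U_sets: "?U \<in> sets lebesgue"
    using meas Q(1) by (intro sets.countable_UN') auto
  then have "?U \<in> lmeasurable"
    by (rule bounded_set_imp_lmeasurable[OF bounded])
  then have "emeasure lebesgue V * \<infinity> \<noteq> top"
    unfolding U[symmetric] by (rule fmeasurableD2)
  then have V_zero: "emeasure lebesgue V = 0"
    by (simp add: ennreal_mult_eq_top_iff)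
  then show ?thesis
    using U_sets by (intro null_setsI) (simp_all only: U V_zero mult_zero_left)
qed

lemma infinite_Rats_Icc_minus_one_one: "infinite (\<rat> \<inter> {-1..1::real})"
proof -
  have "range (\<lambda>n. 1 / real (Suc n)) \<subseteq> \<rat> \<inter> {-1..1}"
    by (auto simp: field_simps intro!: Rats_divide)
  moreover have "inj (\<lambda>n. 1 / real (Suc n))"
    by (auto simp: inj_on_def)
  ultimately show ?thesis
    using infinite_super range_inj_infinite by blast
qed

theorem theoremB1p2:
  shows "\<exists>E :: real set. E \<subseteq> {0..1} \<and> \<not> lebesgue_measurable_set E"
proof -
  define rep :: "real \<Rightarrow> real" where "rep x = (SOME y. y \<in> {0..1} \<and> x - y \<in> \<rat>)" for x
  define V where "V = rep ` {0..1}"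
  define Q :: "real set" where "Q = \<rat> \<inter> {-1..1}"
  let ?U = "\<Union>q\<in>Q. (+) q ` V"
  have rep: "rep x \<in> {0..1} \<and> x - rep x \<in> \<rat>" if "x \<in> {0..1}" for x
    unfolding rep_def by (rule someI[of _ x]) (use that in auto)
  have rep_eq: "rep x = rep y" if "x - y \<in> \<rat>" for x y
  proof -
    have "x - z \<in> \<rat> \<longleftrightarrow> y - z \<in> \<rat>" for z
    proof
      assume "x - z \<in> \<rat>"
      then have "(x - z) - (x - y) \<in> \<rat>"
        using that by (rule Rats_diff)
      then show "y - z \<in> \<rat>" by simp
    next
      assume "y - z \<in> \<rat>"
      with that have "(x - y) + (y - z) \<in> \<rat>"
        by (rule Rats_add)
      then show "x - z \<in> \<rat>" by simp
    qed
    then show ?thesis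
      unfolding rep_def by simp
  qed
  have V: "V \<subseteq> {0..1}"
    using rep unfolding V_def by blast
  have V_inequivalent: "v = w" if vw: "v \<in> V" "w \<in> V" "v - w \<in> \<rat>" for v w
  proof -
    obtain x y where xy: "x \<in> {0..1}" "v = rep x" "y \<in> {0..1}" "w = rep y"
      using vw unfolding V_def by blast
    have "(x - v) + (v - w) - (y - w) \<in> \<rat>"
      using rep[OF xy(1)] rep[OF xy(3)] xy(2,4) vw(3) by (metis Rats_add Rats_diff)
    then show ?thesis
      using rep_eq[of x y] xy by simp
  qed
  have "\<not> lebesgue_measurable_set V"
  proof
    assume "lebesgue_measurable_set V"
    then have V_meas: "V \<in> sets lebesgue"
      by (simp add: lebesgue_measurable_set_iff)
    have disj: "disjoint_family_on (\<lambda>q. (+) q ` V) Q"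
    proof -
      have "p = q" if "p \<in> Q" "q \<in> Q" "v \<in> V" "w \<in> V" "p + v = q + w" for p q v w
      proof -
        have "v - w = q - p"
          using that(5) by simp
        then have "v - w \<in> \<rat>"
          using that(1,2) by (simp add: Q_def)
        then show ?thesis
          using V_inequivalent[of v w] that by simp
      qed
      then show ?thesis
        unfolding disjoint_family_on_def by blast
    qed
    have "?U \<subseteq> {-1..2}"
      using V unfolding Q_def by fastforce
    then have bounded: "bounded ?U"
      by (rule bounded_subset[OF bounded_closed_interval])
    have "?U \<in> null_sets lebesgue"
    proof (rule null_set_if_infinitely_many_disjoint_bounded_translates[OF V_meas _ _ disj bounded])
      show "countable Q"
        unfolding Q_def using countable_rat by (rule countable_subset[rotated]) simp
      show "infinite Q"
        unfolding Q_def by (rule infinite_Rats_Icc_minus_one_one)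
    qed
    moreover have "{0..1} \<subseteq> ?U"
    proof
      fix x :: real
      assume x: "x \<in> {0..1}"
      have "x - rep x \<in> Q"
        using rep[OF x] x unfolding Q_def by auto
      moreover have "x = (x - rep x) + rep x"
        by simp
      ultimately show "x \<in> ?U"
        using x unfolding V_def by blast
    qed
    ultimately have "{0..1::real} \<in> null_sets lebesgue"
      unfolding negligible_iff_null_sets[symmetric] by (rule negligible_subset)
    then show False
      by auto
  qed
  then show ?thesis
    using V by blast
qed

end
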